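(* Every cube tiling of $\mathbb{R}^{3}$ contains a column. That is, if $T\subseteq\mathbb{R}^3$ is such that the cubes $[0,1)^3+t$, $t\in T$, are pairwise disjoint (for distinct $t\in T$) and their union is $\mathbb{R}^3$, then there exist $s\in\mathbb{R}^3$ and $i\in\{1,2,3\}$ such that $s+ke_i\in T$ for every $k\in\mathbb{Z}$, where $e_i$ is the $i$-th element of the standard basis of $\mathbb{R}^3$.
   Context: For $T\subseteq\mathbb{R}^n$, the family $[0,1)^n+T=\{[0,1)^n+t\colon t\in T\}$ is a cube tiling of $\mathbb{R}^n$ if for each pair of distinct $s,t\in T$ the cubes $[0,1)^n+s$ and $[0,1)^n+t$ are disjoint and $\bigcup_{t\in T}([0,1)^n+t)=\mathbb{R}^n$. No periodicity or lattice assumption is made on $T$. A column is a family of cubes of the form $\{[0,1)^n+(s+ke_i)\colon k\in\mathbb{Z}\}$, where $s\in\mathbb{R}^n$ and $e_i$ is an element of the standard basis of $\mathbb{R}^n$; a tiling contains a column if all the cubes of some column belong to the tiling. *)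

theory Defs
  imports "HOL-Analysis.Analysis"
begin

(* The half-open cube [0,1)^n + t.  The interval notation {0..<1} on real^'n is not
   usable here: the strict order on vectors is not componentwise strict. *)
definition cube :: "real ^ 'n \<Rightarrow> (real ^ 'n) set" where
  "cube t = (\<lambda>x. x + t) ` {x. \<forall>i. x $ i \<in> {0..<1}}"

definition cube_tiling :: "(real ^ 'n) set \<Rightarrow> bool" where
  "cube_tiling T \<longleftrightarrow>
     (\<forall>s\<in>T. \<forall>t\<in>T. s \<noteq> t \<longrightarrow> cube s \<inter> cube t = {}) \<and> (\<Union>t\<in>T. cube t) = UNIV"

end

theory Submission
  imports Defs
begin

text \<open>
  The cubes met by a line parallel to a coordinate axis are cut by that line into unit intervals
  tiling it, so their coordinates in that direction form one class modulo \<open>1\<close>. Hence a tiling of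
  \<open>\<real>\<^sup>3\<close> attaches to every vertical line a colour \<open>\<theta> \<in> [0,1)\<close>, the common fractional part of the
  heights of its cubes, and all cubes standing over the same point of the plane have one colour.
  For each \<open>k\<close>, the cubes of colour \<open>\<theta>\<close> and height \<open>\<theta> + k\<close> project to unit squares that tile
  exactly the region of colour \<open>\<theta>\<close>. The heights may therefore be chosen independently for the
  different colours: every \<open>h :: real \<Rightarrow> int\<close> yields a tiling \<open>mix T h\<close> of the plane by unit squares
  (lemma \<open>square_tiling_mix\<close>). Horizontal sections are special cases, but the freedom to
  change the height of one colour alone is what makes the argument work.

  A square tiling of the plane splits into horizontal rows or into vertical columns, that is, its
  squares have ordinates, or abscissae, that agree modulo \<open>1\<close> (\<open>square_tiling_dichotomy\<close>).
  Suppose that all mixes obtained from \<open>h\<close> by changing the value at one colour split into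
  rows, and that no column of \<open>T\<close> runs in the first direction. Then some row of \<open>mix T h\<close> has squares
  of two colours. Changing the height of the first colour keeps the squares of the second; these
  determine the row, so the squares of the first colour are kept as well. Such a square thus
  occurs at every height, which is a column in the third direction (\<open>vertical_column\<close>).

  The hypothesis on the one-colour changes can always be arranged. It holds if every mix splits
  into rows. Otherwise some mix splits only into columns and, after an exchange of the
  first two coordinates, only into rows. A one-colour change of it that splits into columns would
  still contain a square of every row, as every row has a second colour; all these
  squares would agree in their abscissae modulo \<open>1\<close>, so the original mix would split into columns
  too (\<open>columns_persist\<close>). Hence all its one-colour changes split into rows.
\<close>

section \<open>Tilings of the line\<close>

definition interval_tiling :: "real set \<Rightarrow> bool" where
  "interval_tiling X \<longleftrightarrow> (\<forall>x. \<exists>a\<in>X. a \<le> x \<and> x < a + 1) \<and> (\<forall>a\<in>X. \<forall>b\<in>X. \<bar>a - b\<bar> < 1 \<longrightarrow> a = b)"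

lemma frac_eq_iff_add_int: "frac a = frac b \<longleftrightarrow> (\<exists>k::int. b = a + of_int k)" for a b :: real
proof
  assume "frac a = frac b"
  then have "b = a + of_int (\<lfloor>b\<rfloor> - \<lfloor>a\<rfloor>)" by (simp add: frac_def)
  then show "\<exists>k::int. b = a + of_int k" by blast
qed (auto simp: frac_def)

lemma interval_tiling_add_int:
  assumes X: "interval_tiling X" and a: "a \<in> X"
  shows "a + of_int k \<in> X"
proof -
  have cover: "\<exists>a\<in>X. a \<le> x \<and> x < a + 1" for x
    using X by (auto simp: interval_tiling_def)
  have disj: "\<And>a b. a \<in> X \<Longrightarrow> b \<in> X \<Longrightarrow> \<bar>a - b\<bar> < 1 \<Longrightarrow> a = b"
    using X unfolding interval_tiling_def by blast
  have up: "a + 1 \<in> X" if "a \<in> X" for a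
  proof -
    obtain b where b: "b \<in> X" "b \<le> a + 1" "a + 1 < b + 1" using cover by blast
    show ?thesis
    proof (cases "b = a + 1")
      case False
      then have "b = a" using b that by (intro disj) auto
      then show ?thesis using b by simp
    qed (use b in simp)
  qed
  have down: "a - 1 \<in> X" if "a \<in> X" for a
  proof -
    obtain b where b: "b \<in> X" "b \<le> a - 1" "a - 1 < b + 1" using cover by blast
    have "b + 1 = a" using b that up[OF b(1)] by (intro disj) auto
    then have "b = a - 1" by simp
    then show ?thesis using b by simp
  qed
  show ?thesis
  proof (induction k rule: int_induct[where k = 0])
    case (step1 i)
    then show ?case using up[of "a + of_int i"] by (simp add: algebra_simps)
  next
    case (step2 i)
    then show ?case using down[of "a + of_int i"] by (simp add: algebra_simps)
  qed (use a in simp)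
qed

lemma interval_tiling_frac_eq:
  assumes X: "interval_tiling X" and a: "a \<in> X" and b: "b \<in> X"
  shows "frac a = frac b"
proof -
  have "a + of_int \<lfloor>b - a\<rfloor> \<in> X" using interval_tiling_add_int[OF X a] .
  moreover have "\<bar>a + of_int \<lfloor>b - a\<rfloor> - b\<bar> < 1" by linarith
  ultimately have "a + of_int \<lfloor>b - a\<rfloor> = b" using X b unfolding interval_tiling_def by blast
  then show ?thesis unfolding frac_eq_iff_add_int by metis
qed

section \<open>Square tilings of the plane\<close>

text \<open>
  A unit square \<open>[a, a + 1) \<times> [b, b + 1)\<close> is represented by its corner \<open>(a, b)\<close>. Two such squares
  meet iff their corners differ by less than \<open>1\<close> in both coordinates.
\<close>

definition square_tiling :: "(real \<times> real) set \<Rightarrow> bool" where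
  "square_tiling S \<longleftrightarrow>
     (\<forall>x y. \<exists>a b. (a, b) \<in> S \<and> a \<le> x \<and> x < a + 1 \<and> b \<le> y \<and> y < b + 1) \<and>
     (\<forall>a b a' b'. (a, b) \<in> S \<longrightarrow> (a', b') \<in> S \<longrightarrow> \<bar>a - a'\<bar> < 1 \<longrightarrow> \<bar>b - b'\<bar> < 1 \<longrightarrow> a = a' \<and> b = b')"

definition splits_into_rows :: "(real \<times> real) set \<Rightarrow> bool" where
  "splits_into_rows S \<longleftrightarrow> (\<forall>a b a' b'. (a, b) \<in> S \<longrightarrow> (a', b') \<in> S \<longrightarrow> frac b = frac b')"

abbreviation splits_into_columns :: "(real \<times> real) set \<Rightarrow> bool" where
  "splits_into_columns S \<equiv> splits_into_rows (S\<inverse>)"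

lemma square_tiling_converse: "square_tiling S \<Longrightarrow> square_tiling (S\<inverse>)"
  unfolding square_tiling_def converse_iff by blast

lemma square_tiling_line:
  assumes "square_tiling S"
  shows "interval_tiling {a. \<exists>b. (a, b) \<in> S \<and> b \<le> y \<and> y < b + 1}"
  unfolding interval_tiling_def
proof (intro conjI allI ballI impI)
  fix x
  show "\<exists>a\<in>{a. \<exists>b. (a, b) \<in> S \<and> b \<le> y \<and> y < b + 1}. a \<le> x \<and> x < a + 1"
    using assms unfolding square_tiling_def by blast
next
  fix a a'
  assume "a \<in> {a. \<exists>b. (a, b) \<in> S \<and> b \<le> y \<and> y < b + 1}"
    and "a' \<in> {a. \<exists>b. (a, b) \<in> S \<and> b \<le> y \<and> y < b + 1}" and near: "\<bar>a - a'\<bar> < 1"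
  then obtain b b' where "(a, b) \<in> S" "b \<le> y" "y < b + 1" "(a', b') \<in> S" "b' \<le> y" "y < b' + 1"
    by blast
  moreover from this have "\<bar>b - b'\<bar> < 1" by linarith
  ultimately show "a = a'" using assms near unfolding square_tiling_def by blast
qed

lemma square_tiling_row_shift:
  assumes S: "square_tiling S" and rows: "splits_into_rows S" and ab: "(a, b) \<in> S"
  shows "(a + of_int m, b) \<in> S"
proof -
  have "a + of_int m \<in> {a. \<exists>b'. (a, b') \<in> S \<and> b' \<le> b \<and> b < b' + 1}"
    by (rule interval_tiling_add_int[OF square_tiling_line[OF S]]) (use ab in auto)
  then obtain b' where b': "(a + of_int m, b') \<in> S" "b' \<le> b" "b < b' + 1" by blast
  then have "frac b = frac b'" using rows ab unfolding splits_into_rows_def by blast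
  then obtain k where k: "b' = b + of_int k" using frac_eq_iff_add_int by blast
  with b' have "k = 0" by linarith
  with k b' show ?thesis by simp
qed

text \<open>
  The walk \<open>\<alpha> + k\<close>, \<open>\<beta> - m + k\<close>, \<open>\<alpha> + k + 1\<close> with \<open>m\<close> chosen so that these points are
  increasing shares a cell of the first grid at its first step and of the second grid at its
  second step.
\<close>

lemma constant_of_two_grids:
  fixes f :: "real \<Rightarrow> 'a" and \<alpha> \<beta> :: real
  assumes f\<alpha>: "\<And>y y'. \<lfloor>y - \<alpha>\<rfloor> = \<lfloor>y' - \<alpha>\<rfloor> \<Longrightarrow> f y = f y'"
    and f\<beta>: "\<And>y y'. \<lfloor>y - \<beta>\<rfloor> = \<lfloor>y' - \<beta>\<rfloor> \<Longrightarrow> f y = f y'"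
    and ne: "frac \<alpha> \<noteq> frac \<beta>"
  shows "f y = f y'"
proof -
  define m where "m = \<lfloor>\<beta> - \<alpha>\<rfloor>"
  define \<delta> where "\<delta> = \<beta> - \<alpha> - of_int m"
  have "\<delta> \<noteq> 0"
  proof
    assume "\<delta> = 0"
    then have "\<beta> = \<alpha> + of_int m" by (simp add: \<delta>_def)
    with ne show False using frac_eq_iff_add_int by blast
  qed
  moreover have "0 \<le> \<delta>" "\<delta> < 1" unfolding \<delta>_def m_def by linarith+
  ultimately have \<delta>: "0 < \<delta>" "\<delta> < 1" by auto
  have step: "f (\<alpha> + of_int (k + 1)) = f (\<alpha> + of_int k)" for k
  proof -
    have "f (\<alpha> + of_int k) = f (\<alpha> + of_int k + \<delta>)"
      using \<delta> by (intro f\<alpha>) (simp add: floor_eq_iff)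
    also have "\<dots> = f (\<alpha> + of_int (k + 1))"
    proof (rule f\<beta>)
      have "\<lfloor>\<alpha> + of_int k + \<delta> - \<beta>\<rfloor> = k - m"
        using \<delta> by (simp add: floor_eq_iff \<delta>_def)
      moreover have "\<lfloor>\<alpha> + of_int (k + 1) - \<beta>\<rfloor> = k - m"
        using \<delta> by (simp add: floor_eq_iff \<delta>_def)
      ultimately show "\<lfloor>\<alpha> + of_int k + \<delta> - \<beta>\<rfloor> = \<lfloor>\<alpha> + of_int (k + 1) - \<beta>\<rfloor>" by simp
    qed
    finally show ?thesis by simp
  qed
  have grid: "f (\<alpha> + of_int k) = f \<alpha>" for k
  proof (induction k rule: int_induct[where k = 0])
    case (step1 i)
    then show ?case using step[of i] by simp
  next
    case (step2 i)
    then show ?case using step[of "i - 1"] by simp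
  qed simp
  have "f y = f \<alpha>" for y
  proof -
    have "f y = f (\<alpha> + of_int \<lfloor>y - \<alpha>\<rfloor>)" by (intro f\<alpha>) simp
    then show ?thesis using grid by simp
  qed
  then show ?thesis by metis
qed

text \<open>
  Let \<open>f y\<close> be the common fractional part of the abscissae of the squares on the horizontal
  line at ordinate \<open>y\<close>. It is constant on the vertical side of each square, hence on every cell of
  each grid \<open>b + \<int>\<close> formed by the squares on one vertical line. Two different grids
  force \<open>f\<close> to be constant on the whole line.
\<close>

lemma square_tiling_dichotomy:
  assumes S: "square_tiling S"
  shows "splits_into_rows S \<or> splits_into_columns S"
proof (rule disjCI)
  assume "\<not> splits_into_columns S"
  then obtain a b a' b' where ab: "(a, b) \<in> S" "(a', b') \<in> S" "frac a \<noteq> frac a'"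
    unfolding splits_into_rows_def by auto
  define f where "f x = frac (SOME b. \<exists>a. (a, b) \<in> S \<and> a \<le> x \<and> x < a + 1)" for x
  have f_eq: "f x = frac v" if "(u, v) \<in> S" "u \<le> x" "x < u + 1" for u v x
  proof -
    let ?V = "{b. \<exists>a. (b, a) \<in> S\<inverse> \<and> a \<le> x \<and> x < a + 1}"
    have V: "interval_tiling ?V" by (rule square_tiling_line[OF square_tiling_converse[OF S]])
    have v: "v \<in> ?V" using that by auto
    have "(SOME b. b \<in> ?V) \<in> ?V" using v by (rule someI)
    then have "frac (SOME b. b \<in> ?V) = frac v" using interval_tiling_frac_eq[OF V] v by blast
    then show ?thesis by (simp add: f_def)
  qed
  have f_cell: "f x = f x'" if uv: "(u, v) \<in> S" and eq: "\<lfloor>x - u\<rfloor> = \<lfloor>x' - u\<rfloor>" for u v x x'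
  proof -
    have "u + of_int \<lfloor>x - u\<rfloor> \<in> {a. \<exists>b. (a, b) \<in> S \<and> b \<le> v \<and> v < b + 1}"
      by (rule interval_tiling_add_int[OF square_tiling_line[OF S]]) (use uv in auto)
    then obtain w where w: "(u + of_int \<lfloor>x - u\<rfloor>, w) \<in> S" by blast
    have "f x = frac w" by (rule f_eq[OF w]) linarith+
    moreover have "f x' = frac w" by (rule f_eq[OF w]) (use eq in linarith)+
    ultimately show ?thesis by simp
  qed
  have const: "f x = f x'" for x x'
    by (rule constant_of_two_grids[OF f_cell[OF ab(1)] f_cell[OF ab(2)] ab(3)])
  show "splits_into_rows S"
    unfolding splits_into_rows_def
  proof (intro allI impI)
    fix u v u' v' assume "(u, v) \<in> S" "(u', v') \<in> S"
    then have "f u = frac v" "f u' = frac v'" by (auto intro: f_eq)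
    then show "frac v = frac v'" using const by metis
  qed
qed

section \<open>Mixing heights in a tiling of space\<close>

definition box_tiling :: "(real \<times> real \<times> real) set \<Rightarrow> bool" where
  "box_tiling T \<longleftrightarrow>
     (\<forall>x y z. \<exists>a b c. (a, b, c) \<in> T \<and> a \<le> x \<and> x < a + 1 \<and> b \<le> y \<and> y < b + 1 \<and> c \<le> z \<and> z < c + 1) \<and>
     (\<forall>a b c a' b' c'. (a, b, c) \<in> T \<longrightarrow> (a', b', c') \<in> T \<longrightarrow>
        \<bar>a - a'\<bar> < 1 \<longrightarrow> \<bar>b - b'\<bar> < 1 \<longrightarrow> \<bar>c - c'\<bar> < 1 \<longrightarrow> a = a' \<and> b = b' \<and> c = c')"

text \<open>
  The section of the tiling by the horizontal plane at height \<open>z\<close> is the mix with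
  \<open>h \<theta> = \<lfloor>z - \<theta>\<rfloor>\<close>.
\<close>

definition mix :: "(real \<times> real \<times> real) set \<Rightarrow> (real \<Rightarrow> int) \<Rightarrow> (real \<times> real) set" where
  "mix T h = {(a, b). \<exists>\<theta>. 0 \<le> \<theta> \<and> \<theta> < 1 \<and> (a, b, \<theta> + of_int (h \<theta>)) \<in> T}"

lemma box_tiling_line:
  assumes "box_tiling T"
  shows "interval_tiling {c. \<exists>a b. (a, b, c) \<in> T \<and> a \<le> x \<and> x < a + 1 \<and> b \<le> y \<and> y < b + 1}"
    (is "interval_tiling ?V")
  unfolding interval_tiling_def
proof (intro conjI allI ballI impI)
  fix z
  show "\<exists>c\<in>?V. c \<le> z \<and> z < c + 1"
    using assms unfolding box_tiling_def by blast
next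
  fix c c'
  assume "c \<in> ?V" and "c' \<in> ?V" and near: "\<bar>c - c'\<bar> < 1"
  then obtain a b a' b' where "(a, b, c) \<in> T" "a \<le> x" "x < a + 1" "b \<le> y" "y < b + 1"
    "(a', b', c') \<in> T" "a' \<le> x" "x < a' + 1" "b' \<le> y" "y < b' + 1"
    by blast
  moreover from this have "\<bar>a - a'\<bar> < 1" "\<bar>b - b'\<bar> < 1" by linarith+
  ultimately show "c = c'" using assms near unfolding box_tiling_def by blast
qed

lemma box_tiling_colour_eq:
  assumes T: "box_tiling T" and "(a, b, c) \<in> T" "(a', b', c') \<in> T"
    and "\<bar>a - a'\<bar> < 1" "\<bar>b - b'\<bar> < 1"
  shows "frac c = frac c'"
proof (rule interval_tiling_frac_eq[OF box_tiling_line[OF T, of "max a a'" "max b b'"]])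
  have "max a a' < a + 1" "max b b' < b + 1" "max a a' < a' + 1" "max b b' < b' + 1"
    using assms(4,5) by linarith+
  with assms(2,3)
  show "c \<in> {c. \<exists>u v. (u, v, c) \<in> T \<and> u \<le> max a a' \<and> max a a' < u + 1 \<and> v \<le> max b b' \<and> max b b' < v + 1}"
    and "c' \<in> {c. \<exists>u v. (u, v, c) \<in> T \<and> u \<le> max a a' \<and> max a a' < u + 1 \<and> v \<le> max b b' \<and> max b b' < v + 1}"
    by fastforce+
qed

lemma frac_add_int: "0 \<le> \<theta> \<Longrightarrow> \<theta> < 1 \<Longrightarrow> frac (\<theta> + of_int k) = \<theta>" for \<theta> :: real
  by (metis frac_eq frac_eq_iff_add_int)

lemma mem_mix: "0 \<le> \<theta> \<Longrightarrow> \<theta> < 1 \<Longrightarrow> (a, b, \<theta> + of_int (h \<theta>)) \<in> T \<Longrightarrow> (a, b) \<in> mix T h"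
  unfolding mix_def by blast

lemma mixE:
  assumes "(a, b) \<in> mix T h"
  obtains \<theta> where "0 \<le> \<theta>" "\<theta> < 1" "(a, b, \<theta> + of_int (h \<theta>)) \<in> T"
  using assms unfolding mix_def by blast

lemma square_tiling_mix:
  assumes T: "box_tiling T"
  shows "square_tiling (mix T h)"
  unfolding square_tiling_def
proof (intro conjI allI impI)
  fix x y
  let ?V = "{c. \<exists>a b. (a, b, c) \<in> T \<and> a \<le> x \<and> x < a + 1 \<and> b \<le> y \<and> y < b + 1}"
  have V: "interval_tiling ?V" by (rule box_tiling_line[OF T])
  then obtain c where "c \<in> ?V" unfolding interval_tiling_def by meson
  from interval_tiling_add_int[OF V this, of "h (frac c) - \<lfloor>c\<rfloor>"]
  have "frac c + of_int (h (frac c)) \<in> ?V" by (simp add: frac_def algebra_simps)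
  then obtain a b where "(a, b, frac c + of_int (h (frac c))) \<in> T"
    and "a \<le> x" "x < a + 1" "b \<le> y" "y < b + 1" by blast
  moreover from this have "(a, b) \<in> mix T h" by (intro mem_mix[of "frac c"]) (auto simp: frac_lt_1)
  ultimately show "\<exists>a b. (a, b) \<in> mix T h \<and> a \<le> x \<and> x < a + 1 \<and> b \<le> y \<and> y < b + 1" by blast
next
  fix a b a' b'
  assume "(a, b) \<in> mix T h" "(a', b') \<in> mix T h" and near: "\<bar>a - a'\<bar> < 1" "\<bar>b - b'\<bar> < 1"
  then obtain \<theta> \<theta>' where \<theta>: "0 \<le> \<theta>" "\<theta> < 1" "(a, b, \<theta> + of_int (h \<theta>)) \<in> T"
    and \<theta>': "0 \<le> \<theta>'" "\<theta>' < 1" "(a', b', \<theta>' + of_int (h \<theta>')) \<in> T"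
    by (elim mixE)
  have "\<theta> = \<theta>'"
    using box_tiling_colour_eq[OF T \<theta>(3) \<theta>'(3) near] \<theta> \<theta>' by (simp add: frac_add_int)
  then have "a = a' \<and> b = b'" using T \<theta>(3) \<theta>'(3) near unfolding box_tiling_def by fastforce
  then show "a = a'" "b = b'" by auto
qed

text \<open>
  If no column runs in the first direction, no row of a mix has a single colour \<open>\<theta>\<close>, for all its
  cubes would then have the same height \<open>\<theta> + h \<theta>\<close>.
\<close>

lemma row_has_two_colours:
  assumes T: "box_tiling T" and rows: "splits_into_rows (mix T h)"
    and no_column: "\<not> (\<exists>a b c. \<forall>k::int. (a + of_int k, b, c) \<in> T)"
    and ab: "(a, b) \<in> mix T h"
  obtains m :: int and \<theta>' where "0 \<le> \<theta>'" "\<theta>' < 1" "\<theta>' \<noteq> \<theta>"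
    "(a + of_int m, b, \<theta>' + of_int (h \<theta>')) \<in> T"
proof -
  obtain m :: int where m: "(a + of_int m, b, \<theta> + of_int (h \<theta>)) \<notin> T" using no_column by blast
  have "(a + of_int m, b) \<in> mix T h"
    by (rule square_tiling_row_shift[OF square_tiling_mix[OF T] rows ab])
  then obtain \<theta>' where \<theta>': "0 \<le> \<theta>'" "\<theta>' < 1" "(a + of_int m, b, \<theta>' + of_int (h \<theta>')) \<in> T"
    by (elim mixE)
  with m have "\<theta>' \<noteq> \<theta>" by blast
  with \<theta>' show ?thesis by (intro that)
qed

text \<open>
  A square of a second colour survives every change at the colour \<open>\<theta>\<close> and, as long as the mix
  splits into rows, carries the squares of colour \<open>\<theta>\<close> in its row along with it.
\<close>

lemma vertical_column:
  assumes T: "box_tiling T"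
    and rows: "\<And>\<theta> k. splits_into_rows (mix T (h(\<theta> := k)))"
    and no_column: "\<not> (\<exists>a b c. \<forall>k::int. (a + of_int k, b, c) \<in> T)"
  shows "\<exists>a b c. \<forall>k::int. (a, b, c + of_int k) \<in> T"
proof -
  have "\<exists>a b. (a, b) \<in> mix T h" using square_tiling_mix[OF T] unfolding square_tiling_def by blast
  then obtain a b where ab: "(a, b) \<in> mix T h" by blast
  then obtain \<theta> where \<theta>: "0 \<le> \<theta>" "\<theta> < 1" "(a, b, \<theta> + of_int (h \<theta>)) \<in> T" by (elim mixE)
  have "splits_into_rows (mix T h)" using rows[of \<theta> "h \<theta>"] by simp
  then obtain m :: int and \<theta>' where \<theta>': "0 \<le> \<theta>'" "\<theta>' < 1" "\<theta>' \<noteq> \<theta>"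
    "(a + of_int m, b, \<theta>' + of_int (h \<theta>')) \<in> T"
    using row_has_two_colours[OF T _ no_column ab] by metis
  have "(a, b, \<theta> + of_int k) \<in> T" for k
  proof -
    let ?h = "h(\<theta> := k)"
    have "(a + of_int m, b) \<in> mix T ?h" using \<theta>' by (intro mem_mix[of \<theta>']) auto
    from square_tiling_row_shift[OF square_tiling_mix[OF T] rows this, of "- m"]
    have "(a, b) \<in> mix T ?h" by simp
    then obtain \<eta> where \<eta>: "0 \<le> \<eta>" "\<eta> < 1" "(a, b, \<eta> + of_int (?h \<eta>)) \<in> T" by (elim mixE)
    have "\<eta> = \<theta>"
      using box_tiling_colour_eq[OF T \<eta>(3) \<theta>(3)] \<eta> \<theta> by (simp add: frac_add_int)
    with \<eta> show ?thesis by simp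
  qed
  then show ?thesis by blast
qed

text \<open>
  Every row of \<open>mix T h\<close> has a square of a colour other than \<open>\<theta>\<close>, which belongs to the changed mix
  as well and has the same abscissa modulo \<open>1\<close> as the rest of its row.
\<close>

lemma columns_persist:
  assumes T: "box_tiling T" and rows: "splits_into_rows (mix T h)"
    and cols: "splits_into_columns (mix T (h(\<theta> := k)))"
    and no_column: "\<not> (\<exists>a b c. \<forall>k::int. (a + of_int k, b, c) \<in> T)"
  shows "splits_into_columns (mix T h)"
proof -
  have survivor: "\<exists>m::int. (a + of_int m, b) \<in> mix T (h(\<theta> := k))" if "(a, b) \<in> mix T h" for a b
  proof -
    obtain m :: int and \<theta>' where "0 \<le> \<theta>'" "\<theta>' < 1" "\<theta>' \<noteq> \<theta>"
      "(a + of_int m, b, \<theta>' + of_int (h \<theta>')) \<in> T"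
      by (rule row_has_two_colours[OF T rows no_column \<open>(a, b) \<in> mix T h\<close>])
    then have "(a + of_int m, b) \<in> mix T (h(\<theta> := k))" by (intro mem_mix[of \<theta>']) auto
    then show ?thesis by blast
  qed
  have "frac a = frac a'" if ab: "(a, b) \<in> mix T h" and ab': "(a', b') \<in> mix T h" for a b a' b'
  proof -
    obtain m :: int where m: "(a + of_int m, b) \<in> mix T (h(\<theta> := k))"
      using survivor[OF ab] by (elim exE)
    obtain m' :: int where m': "(a' + of_int m', b') \<in> mix T (h(\<theta> := k))"
      using survivor[OF ab'] by (elim exE)
    from m m' have "frac (a + of_int m) = frac (a' + of_int m')"
      using cols unfolding splits_into_rows_def by blast
    moreover have "frac (u + of_int i) = frac u" for u :: real and i :: int
      by (metis frac_eq_iff_add_int)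
    ultimately show ?thesis by simp
  qed
  then show ?thesis unfolding splits_into_rows_def by blast
qed

lemma column_of_one_way_mix:
  assumes T: "box_tiling T" and rows: "splits_into_rows (mix T h)"
    and "\<not> splits_into_columns (mix T h)"
    and no_column: "\<not> (\<exists>a b c. \<forall>k::int. (a + of_int k, b, c) \<in> T)"
  shows "\<exists>a b c. \<forall>k::int. (a, b, c + of_int k) \<in> T"
proof (rule vertical_column[OF T _ no_column])
  fix \<theta> k
  have "\<not> splits_into_columns (mix T (h(\<theta> := k)))"
    using columns_persist[OF T rows _ no_column] assms(3) by blast
  then show "splits_into_rows (mix T (h(\<theta> := k)))"
    using square_tiling_dichotomy[OF square_tiling_mix[OF T]] by blast
qed

section \<open>Columns in tilings of space\<close>

theorem box_tiling_has_column:
  assumes T: "box_tiling T"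
  obtains a b c where "\<forall>k::int. (a + of_int k, b, c) \<in> T"
  | a b c where "\<forall>k::int. (a, b + of_int k, c) \<in> T"
  | a b c where "\<forall>k::int. (a, b, c + of_int k) \<in> T"
proof -
  \<comment> \<open>Exchanging the first two coordinates exchanges the two ways in which a mix can split.\<close>
  let ?T = "{(b, a, c). (a, b, c) \<in> T}"
  have T': "box_tiling ?T"
    unfolding box_tiling_def
  proof (intro conjI allI)
    fix x y z
    show "\<exists>b a c. (b, a, c) \<in> ?T \<and> b \<le> x \<and> x < b + 1 \<and> a \<le> y \<and> y < a + 1 \<and> c \<le> z \<and> z < c + 1"
      using T unfolding box_tiling_def by simp blast
  next
    fix b a c b' a' c'
    show "(b, a, c) \<in> ?T \<longrightarrow> (b', a', c') \<in> ?T \<longrightarrow>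
        \<bar>b - b'\<bar> < 1 \<longrightarrow> \<bar>a - a'\<bar> < 1 \<longrightarrow> \<bar>c - c'\<bar> < 1 \<longrightarrow> b = b' \<and> a = a' \<and> c = c'"
      using T unfolding box_tiling_def by simp
  qed
  have mix': "mix ?T h = (mix T h)\<inverse>" for h unfolding mix_def by auto
  show ?thesis
  proof (rule ccontr)
    assume "\<not> thesis"
    have no1: "\<not> (\<exists>a b c. \<forall>k::int. (a + of_int k, b, c) \<in> T)"
      using that(1) \<open>\<not> thesis\<close> by metis
    have no2: "\<not> (\<exists>a b c. \<forall>k::int. (a, b + of_int k, c) \<in> T)"
      using that(2) \<open>\<not> thesis\<close> by metis
    have no3: "\<not> (\<exists>a b c. \<forall>k::int. (a, b, c + of_int k) \<in> T)"
      using that(3) \<open>\<not> thesis\<close> by metis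
    from no2 have no2': "\<not> (\<exists>b a c. \<forall>k::int. (b + of_int k, a, c) \<in> ?T)" by simp
    from no3 have no3': "\<not> (\<exists>b a c. \<forall>k::int. (b, a, c + of_int k) \<in> ?T)" by simp
    have "splits_into_rows (mix T h)" for h
    proof (rule ccontr)
      assume *: "\<not> splits_into_rows (mix T h)"
      then have "splits_into_columns (mix T h)"
        using square_tiling_dichotomy[OF square_tiling_mix[OF T]] by blast
      with * have "\<exists>b a c. \<forall>k::int. (b, a, c + of_int k) \<in> ?T"
        by (intro column_of_one_way_mix[OF T' _ _ no2', of h]) (simp_all add: mix')
      with no3' show False by blast
    qed
    from vertical_column[OF T this no1] no3 show False by blast
  qed
qed

lemma mem_cube_iff: "x \<in> cube t \<longleftrightarrow> (\<forall>i. t $ i \<le> x $ i \<and> x $ i < t $ i + 1)"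
proof
  assume "\<forall>i. t $ i \<le> x $ i \<and> x $ i < t $ i + 1"
  then have "\<forall>i. (x - t) $ i \<in> {0..<1}" by (simp add: algebra_simps)
  moreover have "x = (x - t) + t" by simp
  ultimately show "x \<in> cube t" unfolding cube_def by blast
qed (auto simp: cube_def)

lemma cubes_meet_iff: "cube s \<inter> cube t \<noteq> {} \<longleftrightarrow> (\<forall>i. \<bar>s $ i - t $ i\<bar> < 1)"
proof
  assume "\<forall>i. \<bar>s $ i - t $ i\<bar> < 1"
  moreover have "max u v < u + 1 \<and> max u v < v + 1" if "\<bar>u - v\<bar> < 1" for u v :: real
    using that by linarith
  ultimately have "(\<chi> i. max (s $ i) (t $ i)) \<in> cube s \<inter> cube t" by (simp add: mem_cube_iff)
  then show "cube s \<inter> cube t \<noteq> {}" by blast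
next
  assume "cube s \<inter> cube t \<noteq> {}"
  then obtain x where x: "x \<in> cube s" "x \<in> cube t" by blast
  show "\<forall>i. \<bar>s $ i - t $ i\<bar> < 1"
  proof
    fix i
    have "s $ i \<le> x $ i \<and> x $ i < s $ i + 1" "t $ i \<le> x $ i \<and> x $ i < t $ i + 1"
      using x by (auto simp: mem_cube_iff)
    then show "\<bar>s $ i - t $ i\<bar> < 1" by linarith
  qed
qed

lemma box_tiling_of_cube_tiling:
  fixes T :: "(real ^ 3) set"
  assumes T: "cube_tiling T"
  shows "box_tiling {(a, b, c). vector [a, b, c] \<in> T}"
  unfolding box_tiling_def
proof (intro conjI allI impI)
  fix x y z :: real
  have "vector [x, y, z] \<in> (\<Union>t\<in>T. cube t)" using T unfolding cube_tiling_def by blast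
  then obtain t where t: "t \<in> T" "vector [x, y, z] \<in> cube t" by blast
  have "vector [t $ 1, t $ 2, t $ 3] = t" by (simp add: vec_eq_iff forall_3)
  with t show "\<exists>a b c. (a, b, c) \<in> {(a, b, c). vector [a, b, c] \<in> T} \<and>
      a \<le> x \<and> x < a + 1 \<and> b \<le> y \<and> y < b + 1 \<and> c \<le> z \<and> z < c + 1"
    by (intro exI[of _ "t $ 1"] exI[of _ "t $ 2"] exI[of _ "t $ 3"])
       (simp add: mem_cube_iff forall_3)
next
  fix a b c a' b' c' :: real
  let ?s = "vector [a, b, c] :: real ^ 3" and ?t = "vector [a', b', c'] :: real ^ 3"
  assume "(a, b, c) \<in> {(a, b, c). vector [a, b, c] \<in> T}"
    and "(a', b', c') \<in> {(a, b, c). vector [a, b, c] \<in> T}"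
    and near: "\<bar>a - a'\<bar> < 1" "\<bar>b - b'\<bar> < 1" "\<bar>c - c'\<bar> < 1"
  then have "?s \<in> T" "?t \<in> T" by auto
  moreover have "cube ?s \<inter> cube ?t \<noteq> {}" using near by (simp add: cubes_meet_iff forall_3)
  ultimately have "?s = ?t" using T unfolding cube_tiling_def by blast
  then show "a = a'" "b = b'" "c = c'" by (auto simp: vec_eq_iff forall_3)
qed

theorem theorem5:
  fixes T :: "(real ^ 3) set"
  assumes "cube_tiling T"
  shows "\<exists>(s :: real ^ 3) (i :: 3). \<forall>k :: int. s + of_int k *\<^sub>R axis i 1 \<in> T"
proof -
  have shift: "vector [a, b, c] + of_int k *\<^sub>R axis 1 1 = (vector [a + of_int k, b, c] :: real ^ 3)"
    "vector [a, b, c] + of_int k *\<^sub>R axis 2 1 = (vector [a, b + of_int k, c] :: real ^ 3)"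
    "vector [a, b, c] + of_int k *\<^sub>R axis 3 1 = (vector [a, b, c + of_int k] :: real ^ 3)"
    for a b c :: real and k :: int
    by (simp_all add: vec_eq_iff forall_3 axis_def)
  show ?thesis
  proof (rule box_tiling_has_column[OF box_tiling_of_cube_tiling[OF assms]])
    fix a b c assume "\<forall>k::int. (a + of_int k, b, c) \<in> {(a, b, c). vector [a, b, c] \<in> T}"
    then show ?thesis by (intro exI[of _ "vector [a, b, c]"] exI[of _ 1]) (simp add: shift)
  next
    fix a b c assume "\<forall>k::int. (a, b + of_int k, c) \<in> {(a, b, c). vector [a, b, c] \<in> T}"
    then show ?thesis by (intro exI[of _ "vector [a, b, c]"] exI[of _ 2]) (simp add: shift)
  next
    fix a b c assume "\<forall>k::int. (a, b, c + of_int k) \<in> {(a, b, c). vector [a, b, c] \<in> T}"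
    then show ?thesis by (intro exI[of _ "vector [a, b, c]"] exI[of _ 3]) (simp add: shift)
  qed
qed

end
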